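(* Let $V$ be a finite set, let $\mathcal{M}=(V,\mathcal{F})$ be a matroid all of whose bases have cardinality $N$, and let $f:2^V\to\mathbb{R}$ be an increasing set function with submodularity ratio $\gamma$ and curvature $\alpha$. Let $S^*$ be an optimal solution of $$\min_{S\subseteq V} f(S)\quad\text{s.t.}\quad S\in\mathcal{F},\ |S|=N.$$ Put $\hat N=|V|-N$, and consider a run of the reverse greedy algorithm on this problem, removing successively $r_1,\dots,r_{\hat N}$, with $R^t=\{r_1,\dots,r_t\}$ (so $R^0=\emptyset$) and output $S^{\mathsf r}=V\setminus R^{\hat N}$. Let $\hat\rho_j(R)=f(V\setminus R)-f((V\setminus R)\setminus j)$ for $R\subseteq V$, $j\in V$. Let $\gamma^{\mathsf{rg}}$ be the largest $\tilde\gamma\in[0,1]$ such that $\tilde\gamma\,\hat\rho_{r_t}(R^{t-1})\le\hat\rho_{r_t}(R^{t-1}\cup R)$ for all $t\in\{1,\dots,\hat N\}$ and all $R\subseteq V\setminus r_t$ with $|R|=\hat N$. Let $\alpha^{\mathsf{rg}}$ be the smallest $\tilde\alpha\in[0,1]$ such that $\hat\rho_r(R^{t-1})\ge(1-\tilde\alpha)\hat\rho_r(R^{\hat N}\cup R)$ for all $t\in\{1,\dots,\hat N\}$, all $R\subseteq V$ with $|R|=t-1$, and all $r\in V\setminus(R^{\hat N}\cup R)$. Assume $f(V)\ne f(S^* )$. Then $\gamma^{\mathsf{rg}}\ge\gamma$, $\alpha^{\mathsf{rg}}\le\alpha$, and $$\frac{f(V)-f(S^{\mathsf r})}{f(V)-f(S^*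 )}\ge\frac{1-\alpha^{\mathsf{rg}}}{1+(1-\gamma^{\mathsf{rg}})(1-\alpha^{\mathsf{rg}})},$$ $$f(S^{\mathsf r})\le\frac{1-\alpha^{\mathsf{rg}}}{1+(1-\gamma^{\mathsf{rg}})(1-\alpha^{\mathsf{rg}})}f(S^* )+\left(1-\frac{1-\alpha^{\mathsf{rg}}}{1+(1-\gamma^{\mathsf{rg}})(1-\alpha^{\mathsf{rg}})}\right)f(V).$$
   Context: Notation: $j$ and $\{j\}$ are identified for singletons; $\rho_j(S)=f(S\cup j)-f(S)$ for $S\subseteq V$, $j\in V$; $\delta_j(S)=f(S)-f(S\setminus j)$ for $j\in S\subseteq V$. The function $f$ is not assumed normalized. $f$ is increasing if $f(S)\le f(R)$ for all $S\subseteq R\subseteq V$. The submodularity ratio of an increasing $f$ is the largest $\gamma\in\mathbb{R}_+$ such that $\gamma\rho_j(R)\le\rho_j(S)$ for all $S\subseteq R\subseteq V$ and all $j\in V\setminus R$ (one has $\gamma\in[0,1]$). The curvature of an increasing $f$ is the smallest $\alpha\in\mathbb{R}_+$ such that $\rho_j(R)\ge(1-\alpha)\rho_j(S)$ for all $S\subseteq R\subseteq V$ and all $j\in V\setminus R$ (one has $\alpha\in[0,1]$). A matroid $(V,\mathcal{F})$ is given by its collection $\mathcal{F}$ of independent sets; bases are the independent sets of maximum cardinality. Reverse greedy algorithm: start with $X^0=V$ and with no element of $V$ marked as considered. For $t=1,\dots,|V|-N$: repeatedly choose $j\in\arg\max\delta_j(X^{t-1})$ over all not yet considered elements $j\in V$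 (ties broken arbitrarily) and mark $j$ as considered (permanently); if $X^{t-1}\setminus j$ does not contain a base of $\mathcal{M}$, keep $j$ in the set and choose again; otherwise set $r_t=j$, $X^t=X^{t-1}\setminus j$ and proceed to the next $t$. The output is $S^{\mathsf r}=X^{|V|-N}$. Thus $X^t=V\setminus R^t$. The quantities $\gamma^{\mathsf{rg}}$ and $\alpha^{\mathsf{rg}}$ are called the reverse greedy submodularity ratio and reverse greedy curvature. *)

theory Defs
  imports Complex_Main
begin

text \<open>
  A set function on the subsets of a finite set \<open>V\<close> is a total function \<open>'a set \<Rightarrow> real\<close>; only its
  values on subsets of \<open>V\<close> are ever used. It is increasing iff \<open>mono_on (Pow V) f\<close>.
\<close>

definition rho :: "('a set \<Rightarrow> real) \<Rightarrow> 'a \<Rightarrow> 'a set \<Rightarrow> real" where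
  "rho f j S = f (S \<union> {j}) - f S"

definition delta :: "('a set \<Rightarrow> real) \<Rightarrow> 'a \<Rightarrow> 'a set \<Rightarrow> real" where
  "delta f j S = f S - f (S - {j})"

definition rho_hat :: "'a set \<Rightarrow> ('a set \<Rightarrow> real) \<Rightarrow> 'a \<Rightarrow> 'a set \<Rightarrow> real" where
  "rho_hat V f j R = f (V - R) - f ((V - R) - {j})"

text \<open>
  If \<open>f\<close> is constant on the subsets of \<open>V\<close>, every \<open>\<gamma>\<close> satisfies the defining inequalities, there is no
  largest one, and the value below is unspecified. For every other increasing \<open>f\<close> the
  maximum is attained and lies in \<open>[0, 1]\<close>.
\<close>

definition submodularity_ratio :: "'a set \<Rightarrow> ('a set \<Rightarrow> real) \<Rightarrow> real" where
  "submodularity_ratio V f =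
    (GREATEST \<gamma>. \<gamma> \<ge> 0 \<and>
      (\<forall>S R. S \<subseteq> R \<and> R \<subseteq> V \<longrightarrow> (\<forall>j\<in>V - R. \<gamma> * rho f j R \<le> rho f j S)))"

definition curvature :: "'a set \<Rightarrow> ('a set \<Rightarrow> real) \<Rightarrow> real" where
  "curvature V f =
    (LEAST \<alpha>. \<alpha> \<ge> 0 \<and>
      (\<forall>S R. S \<subseteq> R \<and> R \<subseteq> V \<longrightarrow> (\<forall>j\<in>V - R. rho f j R \<ge> (1 - \<alpha>) * rho f j S)))"

locale matroid =
  fixes V :: "'a set" and F :: "'a set set"
  assumes finite_ground: "finite V"
    and indep_subset: "I \<in> F \<Longrightarrow> I \<subseteq> V"
    and indep_empty: "{} \<in> F"
    and indep_hereditary: "I \<in> F \<Longrightarrow> J \<subseteq> I \<Longrightarrow> J \<in> F"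
    and indep_augment: "I \<in> F \<Longrightarrow> J \<in> F \<Longrightarrow> card I < card J \<Longrightarrow> \<exists>x\<in>J - I. I \<union> {x} \<in> F"

definition matroid_base :: "'a set set \<Rightarrow> 'a set \<Rightarrow> bool" where
  "matroid_base F B \<longleftrightarrow> is_arg_max card (\<lambda>I. I \<in> F) B"

definition contains_base :: "'a set set \<Rightarrow> 'a set \<Rightarrow> bool" where
  "contains_base F X \<longleftrightarrow> (\<exists>B. matroid_base F B \<and> B \<subseteq> X)"

text \<open>
  \<open>rg_state V F f n X C rs\<close>: the algorithm, which makes \<open>n\<close> removals, can reach a configuration
  with current set \<open>X\<close>, set \<open>C\<close> of considered elements, and list \<open>rs\<close> of elements removed so far in
  order of removal. Nondeterminism covers every way of breaking ties.
\<close>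

inductive rg_state ::
  "'a set \<Rightarrow> 'a set set \<Rightarrow> ('a set \<Rightarrow> real) \<Rightarrow> nat \<Rightarrow> 'a set \<Rightarrow> 'a set \<Rightarrow> 'a list \<Rightarrow> bool"
  for V :: "'a set" and F :: "'a set set" and f :: "'a set \<Rightarrow> real" and n :: nat where
  start: "rg_state V F f n V {} []"
| keep: "rg_state V F f n X C rs \<Longrightarrow> length rs < n \<Longrightarrow>
    is_arg_max (\<lambda>i. delta f i X) (\<lambda>i. i \<in> V - C) j \<Longrightarrow> \<not> contains_base F (X - {j}) \<Longrightarrow>
    rg_state V F f n X (C \<union> {j}) rs"
| remove: "rg_state V F f n X C rs \<Longrightarrow> length rs < n \<Longrightarrow>
    is_arg_max (\<lambda>i. delta f i X) (\<lambda>i. i \<in> V - C) j \<Longrightarrow> contains_base F (X - {j}) \<Longrightarrow>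
    rg_state V F f n (X - {j}) (C \<union> {j}) (rs @ [j])"

definition reverse_greedy_run ::
  "'a set \<Rightarrow> 'a set set \<Rightarrow> ('a set \<Rightarrow> real) \<Rightarrow> nat \<Rightarrow> 'a list \<Rightarrow> 'a set \<Rightarrow> bool" where
  "reverse_greedy_run V F f n rs S \<longleftrightarrow> (\<exists>C. rg_state V F f n S C rs \<and> length rs = n)"

text \<open>Removals are indexed from 1: \<open>r\<^sub>t\<close> is \<open>rs ! (t - 1)\<close>, and \<open>R\<^sup>t\<close> is the following set.\<close>

definition removed :: "'a list \<Rightarrow> nat \<Rightarrow> 'a set" where
  "removed rs t = set (take t rs)"

definition rg_submodularity_ratio ::
  "'a set \<Rightarrow> ('a set \<Rightarrow> real) \<Rightarrow> nat \<Rightarrow> 'a list \<Rightarrow> real" where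
  "rg_submodularity_ratio V f n rs =
    (GREATEST \<gamma>. 0 \<le> \<gamma> \<and> \<gamma> \<le> 1 \<and>
      (\<forall>t\<in>{1..n}. \<forall>R. R \<subseteq> V - {rs ! (t - 1)} \<and> card R = n \<longrightarrow>
        \<gamma> * rho_hat V f (rs ! (t - 1)) (removed rs (t - 1))
          \<le> rho_hat V f (rs ! (t - 1)) (removed rs (t - 1) \<union> R)))"

definition rg_curvature ::
  "'a set \<Rightarrow> ('a set \<Rightarrow> real) \<Rightarrow> nat \<Rightarrow> 'a list \<Rightarrow> real" where
  "rg_curvature V f n rs =
    (LEAST \<alpha>. 0 \<le> \<alpha> \<and> \<alpha> \<le> 1 \<and>
      (\<forall>t\<in>{1..n}. \<forall>R. R \<subseteq> V \<and> card R = t - 1 \<longrightarrow>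
        (\<forall>r\<in>V - (removed rs n \<union> R).
          rho_hat V f r (removed rs (t - 1))
            \<ge> (1 - \<alpha>) * rho_hat V f r (removed rs n \<union> R))))"

end

theory Submission
  imports Defs
begin

text \<open>
  Complementation turns reverse greedy into forward greedy. Put \<open>h R = f V - f (V - R)\<close>; this is
  increasing with \<open>h {} = 0\<close>, its marginals are \<open>rho_hat V f\<close>, and the problem becomes maximising
  \<open>h\<close> over the bases of the dual matroid, whose independent sets are the \<open>A\<close> such that \<open>V - A\<close>
  contains a base. An element rejected by the algorithm stays infeasible for ever, because the
  current set only shrinks, so each removed element \<open>r\<^sub>t\<close> maximises the marginal of \<open>h\<close> at
  \<open>R\<^sup>t\<^sup>-\<^sup>1\<close> among all feasible elements (\<open>rg_state_invariant\<close>).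

  Let \<open>G\<close> be the removed set and \<open>O\<close> the complement of the optimum. Dual exchange
  (\<open>contains_base_exchange\<close>) allows \<open>O\<close> to be enumerated as \<open>o\<^sub>1, ..., o\<^sub>n\<close> such that
  \<open>o\<^sub>t\<close> was available when \<open>r\<^sub>t\<close> was chosen, with \<open>o\<^sub>t = r\<^sub>t\<close> whenever \<open>r\<^sub>t\<close> is in \<open>O\<close>
  (\<open>exchange_matching\<close>). Let \<open>A\<close> be the total gain of the greedy steps with \<open>r\<^sub>t\<close> outside \<open>O\<close>.
  Adding the elements of \<open>O\<close> to \<open>G\<close> in the order of the enumeration, the curvature and the greedy
  choice give \<open>(1 - \<alpha>rg) (h (G \<union> O) - h G) \<le> A\<close>. Adding the elements of \<open>G\<close> to \<open>O\<close> in the order of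
  removal, the submodularity ratio gives \<open>h (G \<union> O) - h O \<ge> \<gamma>rg A\<close>. Eliminating \<open>h (G \<union> O)\<close> and using
  \<open>A \<le> h G\<close> yields
  \<open>(1 - \<alpha>rg) h O \<le> (1 + (1 - \<gamma>rg) (1 - \<alpha>rg)) h G\<close> (\<open>greedy_bound\<close>).

  Both steps instantiate the defining inequalities only at the pairs of sets that the two reverse
  greedy parameters quantify over. Complementing such a pair and deleting the element concerned
  gives a pair that occurs in the definition of \<open>\<gamma>\<close> or \<open>\<alpha>\<close>, which is why \<open>\<gamma>rg \<ge> \<gamma>\<close> and \<open>\<alpha>rg \<le> \<alpha>\<close>.
\<close>

section \<open>Attainment of extremal parameters\<close>

text \<open>
  Each of the four parameters is the extremum of a set of reals cut out by non-strict affine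
  inequalities. Such a set is closed, so the extremum belongs to it and satisfies the inequalities.
\<close>

lemma Greatest_attained:
  fixes P :: "real \<Rightarrow> bool"
  assumes closed: "closed {x. P x}" and ex: "P x0" and bound: "\<forall>x. P x \<longrightarrow> x \<le> b"
  shows "P (GREATEST x. P x)" and "P y \<Longrightarrow> y \<le> (GREATEST x. P x)"
proof -
  have "x0 \<in> {x0..b} \<inter> {x. P x}"
    using ex bound by simp
  then have "compact ({x0..b} \<inter> {x. P x})" "{x0..b} \<inter> {x. P x} \<noteq> {}"
    using closed by (blast intro: compact_Int_closed compact_Icc)+
  from compact_attains_sup[OF this] obtain m
    where "m \<in> {x0..b} \<inter> {x. P x}" "\<forall>t\<in>{x0..b} \<inter> {x. P x}. t \<le> m" by blast
  then have m: "P m" "x0 \<le> m" "\<And>t. P t \<Longrightarrow> x0 \<le> t \<Longrightarrow> t \<le> m"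
    using bound by auto
  then have max: "t \<le> m" if "P t" for t
    using that by (cases "x0 \<le> t") auto
  with \<open>P m\<close> have "(GREATEST x. P x) = m" by (rule Greatest_equality)
  with \<open>P m\<close> max show "P (GREATEST x. P x)" "P y \<Longrightarrow> y \<le> (GREATEST x. P x)" by auto
qed

lemma Least_attained:
  fixes P :: "real \<Rightarrow> bool"
  assumes closed: "closed {x. P x}" and ex: "P x0" and bound: "\<forall>x. P x \<longrightarrow> b \<le> x"
  shows "P (LEAST x. P x)" and "P y \<Longrightarrow> (LEAST x. P x) \<le> y"
proof -
  have "x0 \<in> {b..x0} \<inter> {x. P x}"
    using ex bound by simp
  then have "compact ({b..x0} \<inter> {x. P x})" "{b..x0} \<inter> {x. P x} \<noteq> {}"
    using closed by (blast intro: compact_Int_closed compact_Icc)+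
  from compact_attains_inf[OF this] obtain m
    where "m \<in> {b..x0} \<inter> {x. P x}" "\<forall>t\<in>{b..x0} \<inter> {x. P x}. m \<le> t" by blast
  then have m: "P m" "m \<le> x0" "\<And>t. P t \<Longrightarrow> t \<le> x0 \<Longrightarrow> m \<le> t"
    using bound by auto
  then have min: "m \<le> t" if "P t" for t
    using that by (cases "t \<le> x0") auto
  with \<open>P m\<close> have "(LEAST x. P x) = m" by (rule Least_equality)
  with \<open>P m\<close> min show "P (LEAST x. P x)" "P y \<Longrightarrow> (LEAST x. P x) \<le> y" by auto
qed

lemmas closed_Collect_logic =
  closed_Collect_conj closed_Collect_all closed_Collect_imp open_Collect_const
  closed_Collect_le continuous_intros

lemma rho_nonneg:
  assumes "mono_on (Pow V) f" "S \<subseteq> V" "j \<in> V"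
  shows "0 \<le> rho f j S"
proof -
  have "f S \<le> f (S \<union> {j})"
    using assms by (intro mono_onD[OF assms(1)]) auto
  then show ?thesis by (simp add: rho_def)
qed

lemma rho_hat_eq_rho:
  assumes "r \<in> V" "r \<notin> R"
  shows "rho_hat V f r R = rho f r (V - insert r R)"
proof -
  have "V - R - {r} = V - insert r R" "V - insert r R \<union> {r} = V - R"
    using assms by auto
  then show ?thesis by (simp add: rho_hat_def rho_def)
qed

text \<open>
  For an increasing function that is not constant, some marginal \<open>rho f j S\<close> is positive, and the
  instance \<open>R = S\<close> of the defining inequality then bounds every admissible \<open>\<gamma>\<close> by 1. Without such
  a marginal the maximum would not exist.
\<close>

lemma submodularity_ratio_attained:
  assumes "finite V" and mono: "mono_on (Pow V) f" and "S0 \<subseteq> V" "f V \<noteq> f S0"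
  shows "0 \<le> submodularity_ratio V f" "submodularity_ratio V f \<le> 1"
    and "S \<subseteq> R \<Longrightarrow> R \<subseteq> V \<Longrightarrow> j \<in> V - R \<Longrightarrow>
      submodularity_ratio V f * rho f j R \<le> rho f j S"
proof -
  define P where "P \<gamma> \<longleftrightarrow> \<gamma> \<ge> 0 \<and>
      (\<forall>S R. S \<subseteq> R \<and> R \<subseteq> V \<longrightarrow> (\<forall>j\<in>V - R. \<gamma> * rho f j R \<le> rho f j S))" for \<gamma>
  have eq: "submodularity_ratio V f = (GREATEST \<gamma>. P \<gamma>)"
    by (simp add: submodularity_ratio_def P_def)
  have closed: "closed {\<gamma>. P \<gamma>}"
    unfolding P_def Ball_def by (intro closed_Collect_logic)
  have zero: "P 0"
    unfolding P_def using rho_nonneg[OF mono] by auto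
  have "\<exists>T j. T \<subseteq> V \<and> j \<in> V - T \<and> 0 < rho f j T"
  proof (rule ccontr)
    assume "\<not> ?thesis"
    then have flat: "rho f j T \<le> 0" if "T \<subseteq> V" "j \<in> V - T" for j T
      using that by (meson not_le)
    have "f (S0 \<union> D) = f S0" if "D \<subseteq> V - S0" for D
      using finite_subset[OF that finite_Diff[OF \<open>finite V\<close>]] that
    proof (induction D rule: finite_induct)
      case (insert x D)
      have "rho f x (S0 \<union> D) = 0"
        using insert \<open>S0 \<subseteq> V\<close>
        by (intro antisym flat rho_nonneg[OF mono]) auto
      with insert show ?case by (simp add: rho_def)
    qed simp
    from this[of "V - S0"] \<open>S0 \<subseteq> V\<close> \<open>f V \<noteq> f S0\<close> show False
      by (simp add: Un_absorb1)
  qed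
  then obtain T i where Ti: "T \<subseteq> V" "i \<in> V - T" "0 < rho f i T" by blast
  have bound: "\<forall>\<gamma>. P \<gamma> \<longrightarrow> \<gamma> \<le> 1"
  proof (intro allI impI)
    fix \<gamma> assume "P \<gamma>"
    with Ti have "\<gamma> * rho f i T \<le> rho f i T" unfolding P_def by blast
    with Ti show "\<gamma> \<le> 1" by simp
  qed
  note att = Greatest_attained(1)[of P, OF closed zero bound]
  show "0 \<le> submodularity_ratio V f"
    using att unfolding eq P_def by blast
  show "submodularity_ratio V f \<le> 1"
    using bound att unfolding eq by blast
  show "S \<subseteq> R \<Longrightarrow> R \<subseteq> V \<Longrightarrow> j \<in> V - R \<Longrightarrow>
      submodularity_ratio V f * rho f j R \<le> rho f j S"
    using att unfolding eq P_def by blast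
qed

lemma curvature_attained:
  assumes mono: "mono_on (Pow V) f"
  shows "0 \<le> curvature V f" "curvature V f \<le> 1"
    and "S \<subseteq> R \<Longrightarrow> R \<subseteq> V \<Longrightarrow> j \<in> V - R \<Longrightarrow>
      (1 - curvature V f) * rho f j S \<le> rho f j R"
proof -
  define P where "P \<alpha> \<longleftrightarrow> \<alpha> \<ge> 0 \<and>
      (\<forall>S R. S \<subseteq> R \<and> R \<subseteq> V \<longrightarrow> (\<forall>j\<in>V - R. rho f j R \<ge> (1 - \<alpha>) * rho f j S))" for \<alpha>
  have eq: "curvature V f = (LEAST \<alpha>. P \<alpha>)"
    by (simp add: curvature_def P_def)
  have closed: "closed {\<alpha>. P \<alpha>}"
    unfolding P_def Ball_def by (intro closed_Collect_logic)
  have one: "P 1"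
    unfolding P_def using rho_nonneg[OF mono] by auto
  have bound: "\<forall>\<alpha>. P \<alpha> \<longrightarrow> 0 \<le> \<alpha>"
    by (simp add: P_def)
  note att = Least_attained[of P, OF closed one bound]
  show "0 \<le> curvature V f"
    using bound att(1) unfolding eq by blast
  show "curvature V f \<le> 1"
    using att(2)[OF one] unfolding eq .
  show "S \<subseteq> R \<Longrightarrow> R \<subseteq> V \<Longrightarrow> j \<in> V - R \<Longrightarrow>
      (1 - curvature V f) * rho f j S \<le> rho f j R"
    using att(1) unfolding eq P_def by blast
qed

lemma rg_submodularity_ratio_attained:
  assumes mono: "mono_on (Pow V) f" and rs: "set rs \<subseteq> V" "length rs = n"
  defines "P \<equiv> \<lambda>\<gamma>. \<forall>t\<in>{1..n}. \<forall>R. R \<subseteq> V - {rs ! (t - 1)} \<and> card R = n \<longrightarrow>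
        \<gamma> * rho_hat V f (rs ! (t - 1)) (removed rs (t - 1))
          \<le> rho_hat V f (rs ! (t - 1)) (removed rs (t - 1) \<union> R)"
  shows "0 \<le> rg_submodularity_ratio V f n rs" "rg_submodularity_ratio V f n rs \<le> 1"
    and "P (rg_submodularity_ratio V f n rs)"
    and "0 \<le> \<gamma> \<Longrightarrow> \<gamma> \<le> 1 \<Longrightarrow> P \<gamma> \<Longrightarrow> \<gamma> \<le> rg_submodularity_ratio V f n rs"
proof -
  define Q where "Q \<gamma> \<longleftrightarrow> 0 \<le> \<gamma> \<and> \<gamma> \<le> 1 \<and> P \<gamma>" for \<gamma>
  have eq: "rg_submodularity_ratio V f n rs = (GREATEST \<gamma>. Q \<gamma>)"
    by (simp add: rg_submodularity_ratio_def Q_def P_def)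
  have closed: "closed {\<gamma>. Q \<gamma>}"
    unfolding Q_def P_def Ball_def by (intro closed_Collect_logic)
  have "0 \<le> rho_hat V f j R" for j R
    unfolding rho_hat_def by (simp, rule mono_onD[OF mono]) auto
  then have zero: "Q 0"
    unfolding Q_def P_def by auto
  have bound: "\<forall>\<gamma>. Q \<gamma> \<longrightarrow> \<gamma> \<le> 1"
    by (simp add: Q_def)
  note att = Greatest_attained[of Q, OF closed zero bound]
  show "0 \<le> rg_submodularity_ratio V f n rs" "rg_submodularity_ratio V f n rs \<le> 1"
    and "P (rg_submodularity_ratio V f n rs)"
    using att(1) unfolding eq[symmetric] by (auto simp: Q_def)
  show "0 \<le> \<gamma> \<Longrightarrow> \<gamma> \<le> 1 \<Longrightarrow> P \<gamma> \<Longrightarrow> \<gamma> \<le> rg_submodularity_ratio V f n rs"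
    using att(2) unfolding eq[symmetric] by (auto simp: Q_def)
qed

lemma rg_curvature_attained:
  fixes f :: "'a set \<Rightarrow> real" and n :: nat and rs :: "'a list"
  assumes mono: "mono_on (Pow V) f"
  defines "P \<equiv> \<lambda>\<alpha>. \<forall>t\<in>{1..n}. \<forall>R. R \<subseteq> V \<and> card R = t - 1 \<longrightarrow>
        (\<forall>r\<in>V - (removed rs n \<union> R).
          rho_hat V f r (removed rs (t - 1))
            \<ge> (1 - \<alpha>) * rho_hat V f r (removed rs n \<union> R))"
  shows "0 \<le> rg_curvature V f n rs" "rg_curvature V f n rs \<le> 1"
    and "P (rg_curvature V f n rs)"
    and "0 \<le> \<alpha> \<Longrightarrow> \<alpha> \<le> 1 \<Longrightarrow> P \<alpha> \<Longrightarrow> rg_curvature V f n rs \<le> \<alpha>"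
proof -
  define Q where "Q \<alpha> \<longleftrightarrow> 0 \<le> \<alpha> \<and> \<alpha> \<le> 1 \<and> P \<alpha>" for \<alpha>
  have eq: "rg_curvature V f n rs = (LEAST \<alpha>. Q \<alpha>)"
    by (simp add: rg_curvature_def Q_def P_def)
  have closed: "closed {\<alpha>. Q \<alpha>}"
    unfolding Q_def P_def Ball_def by (intro closed_Collect_logic)
  have "0 \<le> rho_hat V f j R" for j R
    unfolding rho_hat_def by (simp, rule mono_onD[OF mono]) auto
  then have one: "Q 1"
    unfolding Q_def P_def by auto
  have bound: "\<forall>\<alpha>. Q \<alpha> \<longrightarrow> 0 \<le> \<alpha>"
    by (simp add: Q_def)
  note att = Least_attained[of Q, OF closed one bound]
  show "0 \<le> rg_curvature V f n rs" "rg_curvature V f n rs \<le> 1"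
    and "P (rg_curvature V f n rs)"
    using att(1) unfolding eq[symmetric] by (auto simp: Q_def)
  show "0 \<le> \<alpha> \<Longrightarrow> \<alpha> \<le> 1 \<Longrightarrow> P \<alpha> \<Longrightarrow> rg_curvature V f n rs \<le> \<alpha>"
    using att(2) unfolding eq[symmetric] by (auto simp: Q_def)
qed

section \<open>Exchange in the dual matroid\<close>

lemma matroid_base_iff: "matroid_base F B \<longleftrightarrow> B \<in> F \<and> (\<forall>I\<in>F. card I \<le> card B)"
  unfolding matroid_base_def is_arg_max_linorder by auto

lemma contains_base_mono: "contains_base F X \<Longrightarrow> X \<subseteq> Y \<Longrightarrow> contains_base F Y"
  unfolding contains_base_def by blast

lemma (in matroid) extend_to_base:
  assumes "I \<in> F" "matroid_base F B"
  obtains D where "matroid_base F D" "I \<subseteq> D" "D \<subseteq> I \<union> B"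
proof -
  have "\<exists>D. matroid_base F D \<and> I \<subseteq> D \<and> D \<subseteq> I \<union> B"
    using assms
  proof (induction "card B - card I" arbitrary: I rule: less_induct)
    case less
    show ?case
    proof (cases "card I < card B")
      case True
      then obtain x where x: "x \<in> B - I" "I \<union> {x} \<in> F"
        using indep_augment[of I B] less.prems unfolding matroid_base_iff by blast
      have "finite I"
        using indep_subset[OF less.prems(1)] finite_ground finite_subset by blast
      then have "card B - card (I \<union> {x}) < card B - card I"
        using x True by (simp add: card_insert_if)
      from less.hyps[OF this x(2) less.prems(2)] x show ?thesis by blast
    next
      case False
      then have "matroid_base F I"
        using less.prems unfolding matroid_base_iff by (meson le_trans not_less)
      then show ?thesis by blast
    qed
  qed
  then show thesis using that by blast
qed

text \<open>
  Augmentation for the dual matroid. Extend \<open>BB - A\<close>, where \<open>BB\<close> is a base avoiding \<open>B\<close>, by a base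
  avoiding \<open>A\<close>. The resulting base \<open>D\<close> misses \<open>A\<close>, and it cannot contain all of \<open>B - A\<close>: it already
  has the elements of \<open>BB - A\<close>, and \<open>BB\<close> loses to \<open>A\<close> fewer than \<open>card (B - A)\<close> elements.
\<close>

lemma (in matroid) contains_base_exchange:
  assumes A: "A \<subseteq> V" "contains_base F (V - A)"
    and B: "B \<subseteq> V" "contains_base F (V - B)"
    and less: "card A < card B"
  shows "\<exists>x\<in>B - A. contains_base F (V - insert x A)"
proof -
  obtain BA BB where BA: "matroid_base F BA" "BA \<subseteq> V - A"
    and BB: "matroid_base F BB" "BB \<subseteq> V - B"
    using A B unfolding contains_base_def by blast
  have "BB - A \<in> F"
    using BB indep_hereditary[of BB "BB - A"] by (auto simp: matroid_base_iff)
  then obtain D where D: "matroid_base F D" "BB - A \<subseteq> D" "D \<subseteq> (BB - A) \<union> BA"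
    using extend_to_base BA(1) by blast
  have DVA: "D \<subseteq> V - A"
    using D BA BB by blast
  have fin: "finite A" "finite B" "finite BB" "finite D"
    using finite_ground A B BB DVA by (auto intro: finite_subset)
  have "\<not> B - A \<subseteq> D"
  proof
    assume "B - A \<subseteq> D"
    then have "card ((BB - A) \<union> (B - A)) \<le> card D"
      using D fin by (intro card_mono) auto
    moreover have "card ((BB - A) \<union> (B - A)) = card (BB - A) + card (B - A)"
      using BB fin by (intro card_Un_disjoint) auto
    moreover have "card D \<le> card BB"
      using D(1) BB(1) by (auto simp: matroid_base_iff)
    moreover have "card BB = card (BB - A) + card (BB \<inter> A)"
      using card_Int_Diff[OF fin(3), of A] by simp
    moreover have "card (BB \<inter> A) \<le> card (A - B)"
      using BB fin by (intro card_mono) auto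
    moreover have "card A = card (A \<inter> B) + card (A - B)" "card B = card (A \<inter> B) + card (B - A)"
      using card_Int_Diff[OF fin(1), of B] card_Int_Diff[OF fin(2), of A]
      by (simp_all add: Int_commute)
    ultimately show False using less by linarith
  qed
  then obtain x where x: "x \<in> B - A" "x \<notin> D" by blast
  then have "D \<subseteq> V - insert x A" using DVA by blast
  with D(1) x show ?thesis unfolding contains_base_def by blast
qed

text \<open>
  Enumerating \<open>O\<close> backwards makes the exchange property applicable: \<open>t\<close> elements of \<open>O\<close> remain when
  position \<open>t\<close> is filled, against the \<open>t - 1\<close> elements of \<open>rs\<close> before it. Taking \<open>o\<^sub>t = r\<^sub>t\<close> whenever
  possible never conflicts with a later position, because \<open>o\<^sub>s\<close> is not among the first \<open>s - 1\<close>
  elements of \<open>rs\<close>.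
\<close>

lemma exchange_matching:
  fixes indep :: "'a set \<Rightarrow> bool"
  assumes hereditary: "\<And>A B. indep B \<Longrightarrow> A \<subseteq> B \<Longrightarrow> indep A"
    and exchange: "\<And>A B. indep A \<Longrightarrow> indep B \<Longrightarrow> card A < card B \<Longrightarrow>
      \<exists>x\<in>B - A. indep (insert x A)"
    and "distinct rs" "indep (set rs)" "finite Os" "indep Os" "card Os = length rs"
  shows "\<exists>os. set os = Os \<and> length os = length rs \<and> distinct os \<and>
    (\<forall>k<length rs. os ! k \<notin> set (take k rs) \<and> indep (insert (os ! k) (set (take k rs))) \<and>
      (rs ! k \<in> Os \<longrightarrow> os ! k = rs ! k))"
  using assms(3-)
proof (induction rs arbitrary: Os rule: rev_induct)
  case Nil
  then show ?case by auto
next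
  case (snoc r rs)
  have rs: "distinct rs" "r \<notin> set rs" "indep (set rs)"
    using snoc.prems hereditary[of "set (rs @ [r])" "set rs"] by auto
  obtain x where x: "x \<in> Os" "x \<notin> set rs" "indep (insert x (set rs))" "r \<in> Os \<longrightarrow> x = r"
  proof (cases "r \<in> Os")
    case True
    then show ?thesis using that[of r] snoc.prems rs by auto
  next
    case False
    have "card (set rs) < card Os"
      using snoc.prems by (simp add: distinct_card)
    with exchange[OF rs(3) \<open>indep Os\<close>] False that show ?thesis by blast
  qed
  have "indep (Os - {x})" "card (Os - {x}) = length rs"
    using hereditary[OF \<open>indep Os\<close>] snoc.prems x(1) by auto
  then obtain os where os: "set os = Os - {x}" "length os = length rs" "distinct os"
    and at: "\<And>k. k < length rs \<Longrightarrow> os ! k \<notin> set (take k rs) \<and>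
      indep (insert (os ! k) (set (take k rs))) \<and> (rs ! k \<in> Os - {x} \<longrightarrow> os ! k = rs ! k)"
    using snoc.IH[OF rs(1,3), of "Os - {x}"] snoc.prems(3) by auto
  have "(os @ [x]) ! k \<notin> set (take k (rs @ [r])) \<and>
      indep (insert ((os @ [x]) ! k) (set (take k (rs @ [r])))) \<and>
      ((rs @ [r]) ! k \<in> Os \<longrightarrow> (os @ [x]) ! k = (rs @ [r]) ! k)"
    if "k < length (rs @ [r])" for k
  proof (cases "k < length rs")
    case True
    then have "rs ! k \<noteq> x" using x(2) by (metis nth_mem)
    with True at[of k] os(2) show ?thesis by (simp add: nth_append)
  next
    case False
    with that have "k = length rs" by simp
    with x os(2) show ?thesis by (simp add: nth_append)
  qed
  with os x(1) show ?case
    by (intro exI[of _ "os @ [x]"]) auto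
qed

section \<open>Greedy choices of the algorithm\<close>

text \<open>
  The conjunct on \<open>C - set rs\<close> is what makes the greedy conjunct hold: the algorithm maximises only
  over elements that are not yet considered, but a considered element that was kept is infeasible,
  and it remains so as the current set shrinks.
\<close>

lemma rg_state_invariant:
  assumes "rg_state V F f n X C rs" and V: "contains_base F V"
  shows "X = V - set rs \<and> set rs \<subseteq> C \<and> C \<subseteq> V \<and> distinct rs \<and> contains_base F X \<and>
    (\<forall>j\<in>C - set rs. \<not> contains_base F (V - insert j (set rs))) \<and>
    (\<forall>k<length rs. \<forall>i\<in>V - set (take k rs).
      contains_base F (V - insert i (set (take k rs))) \<longrightarrow>
      rho_hat V f i (set (take k rs)) \<le> rho_hat V f (rs ! k) (set (take k rs)))"
  using assms(1)
proof (induction rule: rg_state.induct)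
  case start
  then show ?case using V by simp
next
  case (keep X C rs j)
  have "X - {j} = V - insert j (set rs)" using keep by auto
  with keep show ?case by (auto simp: is_arg_max_linorder)
next
  case (remove X C rs j)
  then have X: "X = V - set rs" and j: "j \<in> V" "j \<notin> C" "set rs \<subseteq> C"
    and max: "\<And>i. i \<in> V - C \<Longrightarrow> delta f i X \<le> delta f j X"
    and stuck: "\<And>i. i \<in> C - set rs \<Longrightarrow> \<not> contains_base F (V - insert i (set rs))"
    by (auto simp: is_arg_max_linorder)
  have Xj: "X - {j} = V - set (rs @ [j])" using X by auto
  have stuck': "\<not> contains_base F (V - insert i (set (rs @ [j])))"
    if "i \<in> C - set rs" for i
    using contains_base_mono[of F "V - insert i (set (rs @ [j]))" "V - insert i (set rs)"]
      stuck[OF that] by auto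
  have last: "rho_hat V f i (set rs) \<le> rho_hat V f j (set rs)"
    if "i \<in> V - set rs" "contains_base F (V - insert i (set rs))" for i
    using that stuck[of i] max[of i] X by (auto simp: rho_hat_def delta_def)
  have greedy: "\<forall>k<length (rs @ [j]). \<forall>i\<in>V - set (take k (rs @ [j])).
      contains_base F (V - insert i (set (take k (rs @ [j])))) \<longrightarrow>
      rho_hat V f i (set (take k (rs @ [j])))
        \<le> rho_hat V f ((rs @ [j]) ! k) (set (take k (rs @ [j])))"
  proof (intro allI impI)
    fix k assume "k < length (rs @ [j])"
    then consider "k < length rs" | "k = length rs" by force
    then show "\<forall>i\<in>V - set (take k (rs @ [j])).
      contains_base F (V - insert i (set (take k (rs @ [j])))) \<longrightarrow>
      rho_hat V f i (set (take k (rs @ [j])))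
        \<le> rho_hat V f ((rs @ [j]) ! k) (set (take k (rs @ [j])))"
    proof cases
      case 1
      with remove.IH show ?thesis by (simp add: nth_append)
    next
      case 2
      with last show ?thesis by simp
    qed
  qed
  from remove.IH have "distinct rs" "C \<subseteq> V" by auto
  with j Xj stuck' greedy remove.hyps show ?case by auto
qed

section \<open>The greedy inequality\<close>

lemma set_take_Suc: "k < length xs \<Longrightarrow> set (take (Suc k) xs) = insert (xs ! k) (set (take k xs))"
  by (simp add: take_Suc_conv_app_nth)

text \<open>
  A forward greedy guarantee for a set function \<open>h\<close>: \<open>rs\<close> lists the greedy solution in order of
  selection and \<open>os\<close> a competitor matched to it. The hypothesis \<open>curv\<close> combines the curvature with
  the greedy choice.
\<close>

lemma greedy_bound:
  fixes h :: "'a set \<Rightarrow> real"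
  assumes len: "length os = length rs" and "h {} = 0"
    and gain: "\<And>k. k < length rs \<Longrightarrow> h (set (take k rs)) \<le> h (set (take (Suc k) rs))"
    and match: "\<And>k. k < length rs \<Longrightarrow> rs ! k \<in> set os \<Longrightarrow> os ! k = rs ! k"
    and curv: "\<And>k. k < length rs \<Longrightarrow> os ! k \<notin> set rs \<Longrightarrow>
      (1 - \<alpha>) * (h (set rs \<union> set (take (Suc k) os)) - h (set rs \<union> set (take k os)))
        \<le> h (set (take (Suc k) rs)) - h (set (take k rs))"
    and sub: "\<And>k. k < length rs \<Longrightarrow> rs ! k \<notin> set os \<Longrightarrow>
      \<gamma> * (h (set (take (Suc k) rs)) - h (set (take k rs)))
        \<le> h (set os \<union> set (take (Suc k) rs)) - h (set os \<union> set (take k rs))"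
    and \<alpha>: "0 \<le> \<alpha>" "\<alpha> \<le> 1" and \<gamma>: "0 \<le> \<gamma>" "\<gamma> \<le> 1"
  shows "(1 - \<alpha>) * h (set os) \<le> (1 + (1 - \<gamma>) * (1 - \<alpha>)) * h (set rs)"
proof -
  let ?n = "length rs"
  define d where "d k = h (set (take (Suc k) rs)) - h (set (take k rs))" for k
  define a where "a k = (if rs ! k \<in> set os then 0 else d k)" for k
  define A where "A = (\<Sum>k<?n. a k)"
  have d_nonneg: "0 \<le> d k" if "k < ?n" for k
    using gain[OF that] by (simp add: d_def)
  have "h (set rs) = (\<Sum>k<?n. d k)"
    unfolding d_def using sum_lessThan_telescope[of "\<lambda>k. h (set (take k rs))" ?n] \<open>h {} = 0\<close> by simp
  moreover have "A \<le> (\<Sum>k<?n. d k)"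
    unfolding A_def a_def by (intro sum_mono) (use d_nonneg in auto)
  ultimately have A_le: "A \<le> h (set rs)" by simp

  have "(1 - \<alpha>) * (h (set rs \<union> set os) - h (set rs))
      = (\<Sum>k<?n. (1 - \<alpha>) * (h (set rs \<union> set (take (Suc k) os)) - h (set rs \<union> set (take k os))))"
    using sum_lessThan_telescope[of "\<lambda>k. h (set rs \<union> set (take k os))" ?n] len
    by (simp add: sum_distrib_left[symmetric])
  also have "\<dots> \<le> A"
    unfolding A_def
  proof (intro sum_mono)
    fix k assume "k \<in> {..<?n}"
    then have k: "k < ?n" by simp
    show "(1 - \<alpha>) * (h (set rs \<union> set (take (Suc k) os)) - h (set rs \<union> set (take k os))) \<le> a k"
    proof (cases "os ! k \<in> set rs")
      \<comment> \<open>A competitor element already in the greedy solution contributes nothing, and \<open>a k \<ge> 0\<close>.\<close>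
      case True
      then have "set rs \<union> set (take (Suc k) os) = set rs \<union> set (take k os)"
        using k len by (auto simp: set_take_Suc)
      then show ?thesis using d_nonneg[OF k] by (simp add: a_def)
    next
      case False
      then have "rs ! k \<notin> set os" using match[OF k] k by (metis nth_mem)
      then show ?thesis using curv[OF k False] by (simp add: a_def d_def)
    qed
  qed
  finally have upper: "(1 - \<alpha>) * (h (set rs \<union> set os) - h (set rs)) \<le> A" .

  have "\<gamma> * A \<le> (\<Sum>k<?n. h (set os \<union> set (take (Suc k) rs)) - h (set os \<union> set (take k rs)))"
    unfolding A_def sum_distrib_left
  proof (intro sum_mono)
    fix k assume "k \<in> {..<?n}"
    then have k: "k < ?n" by simp
    show "\<gamma> * a k \<le> h (set os \<union> set (take (Suc k) rs)) - h (set os \<union> set (take k rs))"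
    proof (cases "rs ! k \<in> set os")
      case True
      then have "set os \<union> set (take (Suc k) rs) = set os \<union> set (take k rs)"
        using k by (auto simp: set_take_Suc)
      with True show ?thesis by (simp add: a_def)
    next
      case False
      then show ?thesis using sub[OF k] by (simp add: a_def d_def)
    qed
  qed
  also have "\<dots> = h (set rs \<union> set os) - h (set os)"
    using sum_lessThan_telescope[of "\<lambda>k. h (set os \<union> set (take k rs))" ?n]
    by (simp add: Un_commute)
  finally have "\<gamma> * A \<le> h (set rs \<union> set os) - h (set os)" .
  then have "(1 - \<alpha>) * (h (set os) + \<gamma> * A - h (set rs))
      \<le> (1 - \<alpha>) * (h (set rs \<union> set os) - h (set rs))"
    using \<alpha> by (intro mult_left_mono) auto
  with upper have "(1 - \<alpha>) * (h (set os) + \<gamma> * A - h (set rs)) \<le> A" by linarith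
  moreover have "(1 - (1 - \<alpha>) * \<gamma>) * A \<le> (1 - (1 - \<alpha>) * \<gamma>) * h (set rs)"
    using A_le \<alpha> \<gamma> by (intro mult_left_mono) (auto intro: mult_le_one)
  ultimately show ?thesis by (simp add: algebra_simps)
qed

section \<open>Comparison of the parameters and the guarantee\<close>

text \<open>
  An element is removed from \<open>V - R\<close> exactly as it would be added to \<open>V - insert r R\<close>, so enlarging
  the set of removed elements shrinks the argument of \<open>rho\<close>, and the inequalities for the whole
  function specialise to those along the run.
\<close>

lemma submodularity_ratio_le_rg:
  assumes "finite V" and mono: "mono_on (Pow V) f" and "S0 \<subseteq> V" "f V \<noteq> f S0"
    and rs: "set rs \<subseteq> V" "distinct rs" "length rs = n"
  shows "submodularity_ratio V f \<le> rg_submodularity_ratio V f n rs"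
proof (rule rg_submodularity_ratio_attained(4)[OF mono rs(1,3)])
  note ratio = submodularity_ratio_attained[OF assms(1-4)]
  show "0 \<le> submodularity_ratio V f" "submodularity_ratio V f \<le> 1" by (fact ratio)+
  show "\<forall>t\<in>{1..n}. \<forall>R. R \<subseteq> V - {rs ! (t - 1)} \<and> card R = n \<longrightarrow>
        submodularity_ratio V f * rho_hat V f (rs ! (t - 1)) (removed rs (t - 1))
          \<le> rho_hat V f (rs ! (t - 1)) (removed rs (t - 1) \<union> R)"
  proof (intro ballI allI impI)
    fix t R assume t: "t \<in> {1..n}" and R: "R \<subseteq> V - {rs ! (t - 1)} \<and> card R = n"
    define r where "r = rs ! (t - 1)"
    have "t - 1 < length rs" using t rs(3) by auto
    then have r: "r \<in> V"
      using rs(1) unfolding r_def by (meson nth_mem subsetD)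
    have new: "r \<notin> removed rs (t - 1)" "r \<notin> R"
      using \<open>t - 1 < length rs\<close> R rs(2) by (auto simp: r_def removed_def in_set_conv_nth nth_eq_iff_index_eq)
    have "submodularity_ratio V f * rho f r (V - insert r (removed rs (t - 1)))
        \<le> rho f r (V - insert r (removed rs (t - 1) \<union> R))"
      using r new by (intro ratio) auto
    with r new show "submodularity_ratio V f * rho_hat V f (rs ! (t - 1)) (removed rs (t - 1))
          \<le> rho_hat V f (rs ! (t - 1)) (removed rs (t - 1) \<union> R)"
      unfolding r_def[symmetric] by (simp add: rho_hat_eq_rho)
  qed
qed

lemma rg_curvature_le:
  assumes mono: "mono_on (Pow V) f"
  shows "rg_curvature V f n rs \<le> curvature V f"
proof (rule rg_curvature_attained(4)[OF mono])
  note curv = curvature_attained[OF mono]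
  show "0 \<le> curvature V f" "curvature V f \<le> 1" by (fact curv)+
  show "\<forall>t\<in>{1..n}. \<forall>R. R \<subseteq> V \<and> card R = t - 1 \<longrightarrow>
        (\<forall>r\<in>V - (removed rs n \<union> R).
          rho_hat V f r (removed rs (t - 1))
            \<ge> (1 - curvature V f) * rho_hat V f r (removed rs n \<union> R))"
  proof (intro ballI allI impI)
    fix t R r assume t: "t \<in> {1..n}" and r: "r \<in> V - (removed rs n \<union> R)"
    have sub: "removed rs (t - 1) \<subseteq> removed rs n"
      using t by (auto simp: removed_def intro!: set_take_subset_set_take)
    have "(1 - curvature V f) * rho f r (V - insert r (removed rs n \<union> R))
        \<le> rho f r (V - insert r (removed rs (t - 1)))"
      using r sub by (intro curv) auto
    then show "rho_hat V f r (removed rs (t - 1))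
            \<ge> (1 - curvature V f) * rho_hat V f r (removed rs n \<union> R)"
      using r sub by (subst (1 2) rho_hat_eq_rho) auto
  qed
qed

theorem corollary2:
  fixes V :: "'a set" and F :: "'a set set" and f :: "'a set \<Rightarrow> real"
    and N Nhat :: nat and rs :: "'a list" and Sopt Srg :: "'a set"
    and \<gamma> \<alpha> \<gamma>rg \<alpha>rg :: real
  assumes "finite V"
    and "matroid V F"
    and "\<And>B. matroid_base F B \<Longrightarrow> card B = N"
    and "mono_on (Pow V) f"
    and "\<gamma> = submodularity_ratio V f"
    and "\<alpha> = curvature V f"
    and "is_arg_min f (\<lambda>S. S \<subseteq> V \<and> S \<in> F \<and> card S = N) Sopt"
    and "Nhat = card V - N"
    and "reverse_greedy_run V F f Nhat rs Srg"
    and "\<gamma>rg = rg_submodularity_ratio V f Nhat rs"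
    and "\<alpha>rg = rg_curvature V f Nhat rs"
    and "f V \<noteq> f Sopt"
  shows "\<gamma>rg \<ge> \<gamma> \<and> \<alpha>rg \<le> \<alpha> \<and>
    (f V - f Srg) / (f V - f Sopt) \<ge> (1 - \<alpha>rg) / (1 + (1 - \<gamma>rg) * (1 - \<alpha>rg)) \<and>
    f Srg \<le> (1 - \<alpha>rg) / (1 + (1 - \<gamma>rg) * (1 - \<alpha>rg)) * f Sopt
      + (1 - (1 - \<alpha>rg) / (1 + (1 - \<gamma>rg) * (1 - \<alpha>rg))) * f V"
proof -
  interpret matroid V F by fact
  define h where "h R = f V - f (V - R)" for R
  have rho_hat: "rho_hat V f j R = h (insert j R) - h R" for j R
  proof -
    have "V - R - {j} = V - insert j R" by blast
    then show ?thesis by (simp add: rho_hat_def h_def)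
  qed
  have mono: "f S \<le> f T" if "S \<subseteq> T" "T \<subseteq> V" for S T
    using that by (intro mono_onD[OF assms(4)]) auto

  have opt: "Sopt \<subseteq> V" "Sopt \<in> F" "card Sopt = N"
    using assms(7) by (auto simp: is_arg_min_linorder)
  \<comment> \<open>\<open>N\<close> is tied to the rank only through the bases, so the optimum is recognised as a base by
    comparison with some base, which exists because \<open>F\<close> is finite and nonempty.\<close>
  have base_opt: "matroid_base F Sopt"
  proof -
    obtain B where "matroid_base F B"
    proof -
      have "finite F"
        using indep_subset finite_ground by (meson Pow_iff finite_Pow_iff finite_subset subsetI)
      then have "Max (card ` F) \<in> card ` F" "\<And>I. I \<in> F \<Longrightarrow> card I \<le> Max (card ` F)"
        using indep_empty by (auto intro!: Max_in)
      then show ?thesis using that unfolding matroid_base_iff by (metis imageE)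
    qed
    with assms(3)[of B] opt show ?thesis by (auto simp: matroid_base_iff)
  qed
  then have base_V: "contains_base F V"
    using opt by (auto simp: contains_base_def)

  obtain C where run: "rg_state V F f Nhat Srg C rs" and len: "length rs = Nhat"
    using assms(9) by (auto simp: reverse_greedy_run_def)
  note inv = rg_state_invariant[OF run base_V]
  have rs: "Srg = V - set rs" "set rs \<subseteq> V" "distinct rs" "contains_base F (V - set rs)"
    using inv by auto
  have greedy: "rho_hat V f i (set (take k rs)) \<le> rho_hat V f (rs ! k) (set (take k rs))"
    if "k < Nhat" "i \<in> V - set (take k rs)" "contains_base F (V - insert i (set (take k rs)))" for k i
    using inv that len by blast

  define Os where "Os = V - Sopt"
  have Os: "Os \<subseteq> V" "finite Os" "V - Os = Sopt" "card Os = length rs"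
    using opt \<open>finite V\<close> assms(8) len
    by (auto simp: Os_def card_Diff_subset finite_subset)
  define coindep where "coindep A \<longleftrightarrow> A \<subseteq> V \<and> contains_base F (V - A)" for A
  have "\<exists>os. set os = Os \<and> length os = length rs \<and> distinct os \<and>
    (\<forall>k<length rs. os ! k \<notin> set (take k rs) \<and> coindep (insert (os ! k) (set (take k rs))) \<and>
      (rs ! k \<in> Os \<longrightarrow> os ! k = rs ! k))"
  proof (rule exchange_matching)
    show "coindep A" if "coindep B" "A \<subseteq> B" for A B
      using that contains_base_mono[of F "V - B" "V - A"] by (auto simp: coindep_def)
    show "\<exists>x\<in>B - A. coindep (insert x A)"
      if "coindep A" "coindep B" "card A < card B" for A B
      using contains_base_exchange[of A B] that by (auto simp: coindep_def)
    show "coindep Os"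
      using Os base_opt by (auto simp: coindep_def contains_base_def)
  qed (use Os rs in \<open>auto simp: coindep_def\<close>)
  then obtain os where os: "set os = Os" "length os = length rs" "distinct os"
    and os_new: "\<And>k. k < length rs \<Longrightarrow> os ! k \<notin> set (take k rs)"
    and os_feasible: "\<And>k. k < length rs \<Longrightarrow>
      os ! k \<in> V \<and> contains_base F (V - insert (os ! k) (set (take k rs)))"
    and os_match: "\<And>k. k < length rs \<Longrightarrow> rs ! k \<in> Os \<Longrightarrow> os ! k = rs ! k"
    by (auto simp: coindep_def)

  note sub_rg = rg_submodularity_ratio_attained[OF assms(4) rs(2) len, folded assms(10)]
  note curv_rg = rg_curvature_attained[OF assms(4), where n = Nhat and rs = rs, folded assms(11)]
  have \<gamma>: "\<gamma>rg \<ge> \<gamma>"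
    unfolding assms(5,10)
    using submodularity_ratio_le_rg[OF assms(1,4) opt(1) assms(12) rs(2,3) len] .
  have \<alpha>: "\<alpha>rg \<le> \<alpha>"
    unfolding assms(6,11) using rg_curvature_le[OF assms(4)] .

  have "(1 - \<alpha>rg) * h (set os) \<le> (1 + (1 - \<gamma>rg) * (1 - \<alpha>rg)) * h (set rs)"
  proof (rule greedy_bound[OF os(2)])
    show "h {} = 0" by (simp add: h_def)
    fix k assume k: "k < length rs"
    show "h (set (take k rs)) \<le> h (set (take (Suc k) rs))"
      unfolding h_def using k by (auto simp: set_take_Suc intro!: mono)
    show "os ! k = rs ! k" if "rs ! k \<in> set os"
      using os_match k that os by simp
    have k': "Suc k \<in> {1..Nhat}" using k len by simp
    show "(1 - \<alpha>rg) * (h (set rs \<union> set (take (Suc k) os)) - h (set rs \<union> set (take k os)))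
        \<le> h (set (take (Suc k) rs)) - h (set (take k rs))"
      if new: "os ! k \<notin> set rs"
    proof -
      let ?R = "set (take k os)"
      have "?R \<subseteq> V" using set_take_subset[of k os] os(1) Os(1) by blast
      moreover have "card ?R = Suc k - 1"
        using k os by (simp add: distinct_card)
      moreover have "os ! k \<in> V - (removed rs Nhat \<union> ?R)"
        using new os os_feasible[OF k] k len
        by (auto simp: removed_def in_set_conv_nth nth_eq_iff_index_eq)
      ultimately have "(1 - \<alpha>rg) * rho_hat V f (os ! k) (removed rs Nhat \<union> ?R)
          \<le> rho_hat V f (os ! k) (removed rs (Suc k - 1))"
        using curv_rg(3) k' by blast
      also have "\<dots> \<le> rho_hat V f (rs ! k) (set (take k rs))"
        using greedy[of k "os ! k"] os_feasible[OF k] os_new[OF k] k len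
        by (simp add: removed_def)
      finally show ?thesis
        using k os(2) len by (simp add: rho_hat set_take_Suc removed_def)
    qed
    show "\<gamma>rg * (h (set (take (Suc k) rs)) - h (set (take k rs)))
        \<le> h (set os \<union> set (take (Suc k) rs)) - h (set os \<union> set (take k rs))"
      if new: "rs ! k \<notin> set os"
    proof -
      have "set os \<subseteq> V - {rs ! (Suc k - 1)}" "card (set os) = Nhat"
        using new os Os len by auto
      then have "\<gamma>rg * rho_hat V f (rs ! (Suc k - 1)) (removed rs (Suc k - 1))
          \<le> rho_hat V f (rs ! (Suc k - 1)) (removed rs (Suc k - 1) \<union> set os)"
        using sub_rg(3) k' by blast
      then show ?thesis
        using k by (simp add: rho_hat set_take_Suc removed_def Un_commute)
    qed
  qed (fact curv_rg(1,2) sub_rg(1,2))+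
  then have bound: "(1 - \<alpha>rg) * (f V - f Sopt) \<le> (1 + (1 - \<gamma>rg) * (1 - \<alpha>rg)) * (f V - f Srg)"
    using os(1) Os(3) rs(1) by (simp add: h_def)

  let ?c = "(1 - \<alpha>rg) / (1 + (1 - \<gamma>rg) * (1 - \<alpha>rg))"
  have opt_pos: "0 < f V - f Sopt"
    using mono[OF opt(1)] assms(12) by simp
  have "0 < 1 + (1 - \<gamma>rg) * (1 - \<alpha>rg)"
    using sub_rg(2) curv_rg(2) by (simp add: add_pos_nonneg)
  then have scaled: "?c * (f V - f Sopt) \<le> f V - f Srg"
    using bound by (simp add: field_simps)
  then have "?c \<le> (f V - f Srg) / (f V - f Sopt)"
    using opt_pos by (simp only: pos_le_divide_eq)
  moreover have "f Srg \<le> ?c * f Sopt + (1 - ?c) * f V"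
    using scaled by (simp only: algebra_simps)
  ultimately show ?thesis using \<gamma> \<alpha> by blast
qed

end
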